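(* Algorithm $\mathcal{D}^2\mathcal{I}$ is optimal: every $2$-sortable permutation, given as input to the $\mathfrak{D}^2\mathfrak{I}$ machine operated by algorithm $\mathcal{D}^2\mathcal{I}$, is output in increasing order.
   Context: The $\mathfrak{D}^2\mathfrak{I}$ machine consists of two decreasing stacks $D_1,D_2$ followed in series by an increasing stack $I$. Elements of $D_1,D_2$ must be in decreasing order from top to bottom (top largest); elements of $I$ in increasing order from top to bottom (top smallest). Operations: $d_0$ pushes the next input element (called $Input$) into $D_1$; $d_1$ moves $Top(D_1)$ to $D_2$; $d_2$ moves $Top(D_2)$ to $I$; $d_3$ pops $Top(I)$ and appends it to the output. An operation is legal if it respects the stack restrictions. A permutation is $2$-sortable if some sequence of legal operations outputs its elements in increasing order. Any comparison involving an empty stack is considered true. Conditions: ($\alpha$) $Top(D_2)<Top(I)$; ($\beta$) $Top(D_2)<Top(D_1)$ and $Top(D_1)<Top(I)$; ($\gamma$) $Top(D_1)<Input$, $Input<Top(I)$, and the sequence of input elements from $Input$ up to the first input element larger than $Top(D_2)$ is increasing. Algorithm $\mathcal{D}^2\mathcal{I}$ repeatedly executes the first applicable instruction among: 1. if $Top(I)$ is the next element to be output (the smallest element not yet output), perform $d_3$; 2. if the elements contained in $D_1\cup D_2$ are exactly the next elements to be output, move them to the output in increasing order; 3. perform $d_1$ if it is legal and ($\beta$) holds; 4. perform $d_0$ if it is legal and ($\gamma$) holds; 5. perform $d_2$ if it is legal and ($\alpha$) holds; 6. otherwise perform $d_3$. *)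

theory Defs
  imports Main
begin

text \<open>State of the D^2 I machine. Stacks are lists whose head is the top.\<close>
datatype state = St (inp: "nat list") (d1: "nat list") (d2: "nat list") (ist: "nat list") (out: "nat list")

definition top :: "nat list \<Rightarrow> nat option" where
  "top xs = (case xs of [] \<Rightarrow> None | x # _ \<Rightarrow> Some x)"

fun ltE :: "nat option \<Rightarrow> nat option \<Rightarrow> bool" where
  "ltE (Some a) (Some b) = (a < b)"
| "ltE _ _ = True"

definition init :: "nat list \<Rightarrow> state" where
  "init p = St p [] [] [] []"

definition legal_d0 :: "state \<Rightarrow> bool" where
  "legal_d0 s \<longleftrightarrow> inp s \<noteq> [] \<and> ltE (top (d1 s)) (top (inp s))"
definition legal_d1 :: "state \<Rightarrow> bool" where
  "legal_d1 s \<longleftrightarrow> d1 s \<noteq> [] \<and> ltE (top (d2 s)) (top (d1 s))"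
definition legal_d2 :: "state \<Rightarrow> bool" where
  "legal_d2 s \<longleftrightarrow> d2 s \<noteq> [] \<and> ltE (top (d2 s)) (top (ist s))"
definition legal_d3 :: "state \<Rightarrow> bool" where
  "legal_d3 s \<longleftrightarrow> ist s \<noteq> []"

definition do_d0 :: "state \<Rightarrow> state" where
  "do_d0 s = St (tl (inp s)) (hd (inp s) # d1 s) (d2 s) (ist s) (out s)"
definition do_d1 :: "state \<Rightarrow> state" where
  "do_d1 s = St (inp s) (tl (d1 s)) (hd (d1 s) # d2 s) (ist s) (out s)"
definition do_d2 :: "state \<Rightarrow> state" where
  "do_d2 s = St (inp s) (d1 s) (tl (d2 s)) (hd (d2 s) # ist s) (out s)"
definition do_d3 :: "state \<Rightarrow> state" where
  "do_d3 s = St (inp s) (d1 s) (d2 s) (tl (ist s)) (out s @ [hd (ist s)])"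

definition mstep :: "state \<Rightarrow> state \<Rightarrow> bool" where
  "mstep s s' \<longleftrightarrow>
     (legal_d0 s \<and> s' = do_d0 s) \<or> (legal_d1 s \<and> s' = do_d1 s) \<or>
     (legal_d2 s \<and> s' = do_d2 s) \<or> (legal_d3 s \<and> s' = do_d3 s)"

definition two_sortable :: "nat list \<Rightarrow> bool" where
  "two_sortable p \<longleftrightarrow> (\<exists>s. mstep\<^sup>*\<^sup>* (init p) s \<and> out s = sort p)"

definition remaining :: "state \<Rightarrow> nat set" where
  "remaining s = set (inp s) \<union> set (d1 s) \<union> set (d2 s) \<union> set (ist s)"

definition finished :: "state \<Rightarrow> bool" where
  "finished s \<longleftrightarrow> inp s = [] \<and> d1 s = [] \<and> d2 s = [] \<and> ist s = []"

definition cond_alpha :: "state \<Rightarrow> bool" where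
  "cond_alpha s \<longleftrightarrow> ltE (top (d2 s)) (top (ist s))"
definition cond_beta :: "state \<Rightarrow> bool" where
  "cond_beta s \<longleftrightarrow> ltE (top (d2 s)) (top (d1 s)) \<and> ltE (top (d1 s)) (top (ist s))"

text \<open>The input elements from Input up to (and including) the first input element
  larger than the given value (all remaining input if there is none; with an empty
  D2 the comparison is true, so the segment is just Input).\<close>
fun segment :: "nat option \<Rightarrow> nat list \<Rightarrow> nat list" where
  "segment None xs = take 1 xs"
| "segment (Some t) xs = takeWhile (\<lambda>x. x \<le> t) xs @ take 1 (dropWhile (\<lambda>x. x \<le> t) xs)"

definition cond_gamma :: "state \<Rightarrow> bool" where
  "cond_gamma s \<longleftrightarrow> ltE (top (d1 s)) (top (inp s)) \<and> ltE (top (inp s)) (top (ist s)) \<and>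
     sorted_wrt (<) (segment (top (d2 s)) (inp s))"

text \<open>Instruction 2: the elements of D1 \<union> D2 (nonempty) are exactly the next elements
  to be output, i.e. they are all smaller than every other element not yet output.\<close>
definition cond_flush :: "state \<Rightarrow> bool" where
  "cond_flush s \<longleftrightarrow> (let D = set (d1 s) \<union> set (d2 s) in
      D \<noteq> {} \<and> (\<forall>x\<in>D. \<forall>y\<in>remaining s - D. x < y))"
definition do_flush :: "state \<Rightarrow> state" where
  "do_flush s = St (inp s) [] [] (ist s) (out s @ sort (d1 s @ d2 s))"

definition alg_step :: "state \<Rightarrow> state option" where
  "alg_step s =
    (if finished s then None
     else if ist s \<noteq> [] \<and> hd (ist s) = Min (remaining s) then Some (do_d3 s)
     else if cond_flush s then Some (do_flush s)
     else if legal_d1 s \<and> cond_beta s then Some (do_d1 s)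
     else if legal_d0 s \<and> cond_gamma s then Some (do_d0 s)
     else if legal_d2 s \<and> cond_alpha s then Some (do_d2 s)
     else if legal_d3 s then Some (do_d3 s)
     else None)"

definition alg_rel :: "state \<Rightarrow> state \<Rightarrow> bool" where
  "alg_rel s s' \<longleftrightarrow> alg_step s = Some s'"

end

theory Submission
  imports Defs "HOL-Library.Multiset"
begin

text \<open>Call a state completable if some legal sequence of operations outputs all its remaining
  elements in increasing order. Every step of the algorithm preserves completability, whatever
  well-formed state it starts from. Deleting elements from a state preserves completability, which
  settles the first two instructions. For the others the key is that an element \<open>k\<close> of the
  increasing stack can be crossed by no larger element before every smaller one has passed. So
  whenever the first operation of a successful run differs from the one chosen by the algorithm,
  either the chosen operation can be moved to the front of the run, or the elements of the
  decreasing stacks, possibly together with an increasing piece of the input, are the smallest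
  remaining ones and can be output at once.\<close>

section \<open>Completable configurations\<close>

definition proper :: "nat list \<Rightarrow> nat list \<Rightarrow> nat list \<Rightarrow> nat list \<Rightarrow> bool" where
  "proper i a b c \<longleftrightarrow>
     sorted_wrt (>) a \<and> sorted_wrt (>) b \<and> sorted_wrt (<) c \<and> distinct (i @ a @ b @ c)"

text \<open>The rules read a successful run backwards in time. In \<open>shift\<close> and
  \<open>rise\<close> the side condition restores the order of the stack that the element left; the
  order of the receiving stack comes with the premise, by \<open>completable_proper\<close>. No
  output is recorded, since \<open>leave\<close> demands the least remaining element.\<close>

inductive completable :: "nat list \<Rightarrow> nat list \<Rightarrow> nat list \<Rightarrow> nat list \<Rightarrow> bool" where
  empty: "completable [] [] [] []"
| enter: "completable i (u # a) b c \<Longrightarrow> completable (u # i) a b c"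
| shift: "completable i a (x # b) c \<Longrightarrow> \<forall>y\<in>set a. y < x \<Longrightarrow> completable i (x # a) b c"
| rise: "completable i a b (t # c) \<Longrightarrow> \<forall>y\<in>set b. y < t \<Longrightarrow> completable i a (t # b) c"
| leave: "completable i a b c \<Longrightarrow> \<forall>y\<in>set i \<union> set a \<union> set b \<union> set c. m < y
    \<Longrightarrow> completable i a b (m # c)"

lemma completable_proper: "completable i a b c \<Longrightarrow> proper i a b c"
  by (induction rule: completable.induct) (auto simp: proper_def)

lemma completable_filter:
  "completable i a b c \<Longrightarrow> completable (filter P i) (filter P a) (filter P b) (filter P c)"
proof (induction rule: completable.induct)
  case empty
  show ?case by (simp add: completable.empty)
next
  case (enter i u a b c)
  then show ?case by (auto intro: completable.enter)
next
  case (shift i a x b c)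
  then show ?case by (auto intro: completable.shift)
next
  case (rise i a b t c)
  then show ?case by (auto intro: completable.rise)
next
  case (leave i a b c m)
  then show ?case by (auto intro: completable.leave)
qed

text \<open>A larger element \<open>v\<close> ahead of a smaller element \<open>w\<close> would have to cross \<open>k\<close>: it cannot enter
  the increasing stack while \<open>k\<close> is there, and \<open>k\<close> waits for \<open>w\<close>. The case \<open>v \<in> D\<^sub>1\<close>, \<open>w \<in> D\<^sub>2\<close> is
  absent because there \<open>w\<close> can go first.\<close>
lemma completable_crossing:
  assumes "completable i a b c" "k \<in> set c"
  shows "(\<forall>v\<in>set b. \<forall>w\<in>set i \<union> set a \<union> set b. \<not> (w < k \<and> k < v)) \<and>
    (\<forall>v\<in>set a. \<forall>w\<in>set i \<union> set a. \<not> (w < k \<and> k < v)) \<and>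
    sorted_wrt (\<lambda>v w. \<not> (w < k \<and> k < v)) i"
  using assms
proof (induction rule: completable.induct)
  case empty
  then show ?case by simp
next
  case (enter i u a b c)
  then show ?case by auto
next
  case (shift i a x b c)
  have "\<not> (x < k \<and> k < v)" if "v \<in> set a" for v
    using bspec[OF shift.hyps(2) that] by linarith
  with shift.IH shift.prems show ?case by auto
next
  case (rise i a b t c)
  from completable_proper[OF rise.hyps(1)] have "t < k"
    using rise.prems by (auto simp: proper_def)
  then have "\<not> k < v" if "v \<in> set (t # b)" for v
    using rise.hyps(2) that by (metis order.asym order.strict_trans set_ConsD)
  with rise.IH rise.prems show ?case by auto
next
  case (leave i a b c m)
  then show ?case
  proof (cases "k = m")
    case True
    have "\<not> w < m" if "w \<in> set i \<union> set a \<union> set b" for w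
      using leave.hyps(2) that order.asym by blast
    then show ?thesis unfolding True by (auto simp: sorted_wrt_iff_nth_less)
  qed auto
qed

section \<open>Emptying the decreasing stacks\<close>

lemma distinct_if_decreasing: "sorted_wrt (>) (xs :: nat list) \<Longrightarrow> distinct xs"
  by (induction xs) auto

lemma completable_leave_append:
  assumes "completable i a b c" "sorted_wrt (<) ys"
    "\<forall>y\<in>set ys. \<forall>w\<in>set i \<union> set a \<union> set b \<union> set c. y < w"
  shows "completable i a b (ys @ c)"
  using assms(2,3)
proof (induction ys)
  case Nil
  then show ?case using assms(1) by simp
next
  case (Cons y ys)
  then have "completable i a b (ys @ c)" by simp
  with Cons.prems show ?case by (auto intro!: completable.leave)
qed

text \<open>The largest element of \<open>ys\<close> goes into the increasing stack first: it is the
  top of \<open>b\<close>, or it is the top of \<open>a\<close> and exceeds all of \<open>b\<close>,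
  so it can pass through \<open>D2\<close>. Repeating this stacks up \<open>ys\<close> in order and
  leaves \<open>a'\<close>.\<close>

lemma completable_merge:
  assumes "completable i a' [] (ys @ c)" "sorted_wrt (<) ys" "set ys = set a \<union> set b"
    "sorted_wrt (>) (a @ a')" "sorted_wrt (>) b" "distinct (a @ b)"
  shows "completable i (a @ a') b c"
  using assms
proof (induction "length a + length b" arbitrary: a b c ys rule: less_induct)
  case less
  show ?case
  proof (cases "a = [] \<and> b = []")
    case True
    with less.prems show ?thesis by simp
  next
    case False
    then have "ys \<noteq> []" using less.prems(3) by auto
    then obtain zs m where ys: "ys = zs @ [m]" by (metis rev_exhaust)
    have zs: "sorted_wrt (<) zs" "\<forall>z\<in>set zs. z < m"
      using less.prems(2) by (auto simp: ys sorted_wrt_append)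
    have comp: "completable i a' [] (zs @ m # c)"
      using less.prems(1) by (simp add: ys)
    have m: "m \<in> set a \<union> set b" "\<forall>y\<in>set a \<union> set b. y \<noteq> m \<longrightarrow> y < m" "m \<notin> set zs"
      using less.prems(3) zs by (auto simp: ys)
    show ?thesis
    proof (cases "m \<in> set b")
      case True
      then obtain b' where b: "b = m # b'"
        using less.prems(5) m(2) by (cases b) (auto dest: order.asym)
      have "set zs = set a \<union> set b'"
        using less.prems(3,6) m(3) by (auto simp: ys b)
      with less.hyps[of a b' zs "m # c"] comp zs less.prems
      have "completable i (a @ a') b' (m # c)" by (auto simp: b)
      then show ?thesis using less.prems(5) by (auto simp: b intro: completable.rise)
    next
      case False
      with m(1) have "m \<in> set a" by simp
      then obtain a1 where a: "a = m # a1"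
        using less.prems(4) m(2) by (cases a) (auto dest: order.asym)
      have "set zs = set a1 \<union> set b"
        using less.prems(3,6) m(3) by (auto simp: ys a)
      with less.hyps[of a1 b zs "m # c"] comp zs less.prems
      have "completable i (a1 @ a') b (m # c)" by (auto simp: a)
      moreover have "\<forall>y\<in>set b. y < m" using m(2) False by auto
      ultimately have "completable i (a1 @ a') (m # b) c" by (auto intro: completable.rise)
      then show ?thesis using less.prems(4) by (auto simp: a intro: completable.shift)
    qed
  qed
qed

lemma completable_flush:
  assumes "completable i a' [] c" "sorted_wrt (>) (a @ a')" "sorted_wrt (>) b" "distinct (a @ b)"
    "\<forall>y\<in>set a \<union> set b. \<forall>w\<in>set i \<union> set a' \<union> set c. y < w"
  shows "completable i (a @ a') b c"
proof (rule completable_merge)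
  show "completable i a' [] (sort (a @ b) @ c)"
    using assms by (intro completable_leave_append) (auto simp: strict_sorted_iff)
qed (use assms in \<open>auto simp: strict_sorted_iff\<close>)

text \<open>By the last hypothesis the least element outside \<open>b'\<close> is not yet in
  \<open>c\<close>, so nothing leaves before it rises. When it rises, \<open>b\<close> must be
  empty, because \<open>b\<close> lies below it; then \<open>b'\<close> is exposed and can be
  flushed on top of it.\<close>

lemma completable_below_bottom:
  assumes "completable i a b c" "sorted_wrt (>) b'"
    "\<forall>y\<in>set b'. \<forall>w\<in>set i \<union> set a \<union> set b \<union> set c. y < w"
    "\<exists>w\<in>set i \<union> set a \<union> set b. \<forall>y\<in>set c. w < y"
  shows "completable i a (b @ b') c"
  using assms
proof (induction rule: completable.induct)
  case empty
  then show ?case by simp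
next
  case (enter i u a b c)
  then show ?case by (auto intro!: completable.enter)
next
  case (shift i a x b c)
  then show ?case by (auto intro!: completable.shift)
next
  case (rise i a b t c)
  note pr = completable_proper[OF rise.hyps(1)]
  have "completable i a (b @ b') (t # c)"
  proof (cases "\<exists>w\<in>set i \<union> set a \<union> set b. w < t")
    case True
    then obtain w where w: "w \<in> set i \<union> set a \<union> set b" "w < t" by blast
    with pr have "\<forall>y\<in>set (t # c). w < y" by (auto simp: proper_def)
    with w rise show ?thesis by auto
  next
    case False
    with rise.hyps have b: "b = []" by (cases b) auto
    have "completable i ([] @ a) b' (t # c)"
      using rise.hyps(1) rise.prems pr
      by (intro completable_flush) (auto simp: b proper_def distinct_if_decreasing)
    then show ?thesis by (simp add: b)
  qed
  with rise show ?case by (auto intro!: completable.rise)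
next
  case (leave i a b c m)
  then show ?case by (auto dest: order.asym)
qed

section \<open>The third instruction: from \<open>D1\<close> to \<open>D2\<close>\<close>

text \<open>Simulation: \<open>z\<close> and \<open>z'\<close> are the elements that the given run has placed above \<open>x\<close> in \<open>D\<^sub>1\<close>
  and above \<open>b\<close> in \<open>D\<^sub>2\<close>; in the simulating run \<open>x\<close> already lies in \<open>D\<^sub>2\<close>. The runs meet when the
  given one moves \<open>x\<close>. If it first takes an element off \<open>b\<close>, then \<open>b\<close> consists of the smallest
  remaining elements and may be ignored.\<close>
lemma completable_shift_top:
  assumes "completable i (z @ x # a) (z' @ b) c"
    "\<forall>y\<in>set z \<union> set z' \<union> set c. x < y" "\<forall>y\<in>set b. y < x"
  shows "completable i (z @ a) (z' @ x # b) c"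
  using assms
\<comment> \<open>The induction is on a weight and not on the run, because the hypothesis is also
  applied to the configuration with \<open>b\<close> deleted.\<close>
proof (induction "4 * length i + 3 * (length z + length a) + 2 * (length z' + length b) + length c"
    arbitrary: i z a z' b c rule: less_induct)
  case less
  from less.prems(1) show ?case
  proof (cases rule: completable.cases)
    case empty
    then show ?thesis by simp
  next
    case (enter i' u)
    from completable_proper[OF enter(2)] have "x < u" by (auto simp: proper_def)
    then have "completable i' ((u # z) @ a) (z' @ x # b) c"
      using enter less.prems by (intro less.hyps) auto
    then show ?thesis by (simp add: enter(1) completable.enter)
  next
    case (shift a0 y)
    show ?thesis
    proof (cases z)
      case Nil
      then have "y = x" "a0 = a" using shift(1) by auto
      \<comment> \<open>An element of \<open>z'\<close> exceeds \<open>x\<close>, so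
        \<open>x\<close> could not be pushed onto it. Here the two runs meet.\<close>
      moreover have "z' = []"
        using completable_proper[OF shift(2)] less.prems(2) \<open>y = x\<close>
        by (cases z') (auto simp: proper_def)
      ultimately show ?thesis using shift Nil by simp
    next
      case (Cons y' z1)
      with shift have eq: "y' = y" "a0 = z1 @ x # a" by auto
      then have "completable i (z1 @ a) ((y # z') @ x # b) c"
        using shift less.prems Cons by (intro less.hyps) auto
      then show ?thesis using shift(3) by (auto simp: Cons eq intro!: completable.shift)
    qed
  next
    case (rise b0 t)
    show ?thesis
    proof (cases z')
      case (Cons t' z1)
      with rise have eq: "t' = t" "b0 = z1 @ b" by auto
      then have "completable i (z @ a) (z1 @ x # b) (t # c)"
        using rise less.prems Cons by (intro less.hyps) auto
      then show ?thesis using rise(3) less.prems(2) by (auto simp: Cons eq intro!: completable.rise)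
    next
      case Nil
      with rise have b: "b = t # b0" by simp
      note pr = completable_proper[OF rise(2)]
      have "t < x" using less.prems(3) b by simp
      \<comment> \<open>Once \<open>t\<close> has risen, \<open>x > t\<close> is still in
        \<open>D1\<close>, so nothing in the input or \<open>D1\<close> can be smaller than
        \<open>t\<close>.\<close>
      have "\<not> w < t" if "w \<in> set i \<union> set (z @ x # a)" for w
        using completable_crossing[OF rise(2), of t] that \<open>t < x\<close> by auto
      moreover have "w \<noteq> t" if "w \<in> set i \<union> set (z @ x # a)" for w
        using pr that by (auto simp: proper_def)
      ultimately have above: "t < w" if "w \<in> set i \<union> set (z @ x # a)" for w
        using that linorder_neqE_nat by blast
      have t_min: "\<forall>y\<in>set b. y \<le> t" using rise(3) b by auto
      have "t < w" if "w \<in> set i \<union> set (z @ x # a) \<union> set c" for w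
        using above that pr by (auto simp: proper_def)
      then have "filter ((<) t) i = i" "filter ((<) t) (z @ x # a) = z @ x # a"
          "filter ((<) t) (t # c) = c"
        by (auto simp: filter_id_conv)
      moreover have "filter ((<) t) b0 = []" using rise(3) by (auto simp: filter_empty_conv)
      ultimately have "completable i (z @ x # a) [] c"
        using completable_filter[OF rise(2), of "(<) t"] by metis
      \<comment> \<open>Without \<open>b\<close> the weight is smaller. Afterwards \<open>b\<close>
        is put back under \<open>x\<close>, and \<open>x\<close> itself witnesses that the least
        element outside \<open>b\<close> is not in \<open>c\<close>.\<close>
      then have "completable i (z @ a) [x] c"
        using less.hyps[of i z a "[]" "[]" c] less.prems(2) b Nil by auto
      moreover have "y < w" if "y \<in> set b" "w \<in> set i \<union> set (z @ a) \<union> set [x] \<union> set c" for y w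
      proof -
        have "t < w" using above[of w] pr that(2) by (auto simp: proper_def)
        then show ?thesis using t_min that(1) order.strict_trans1 by blast
      qed
      moreover have "sorted_wrt (>) b" using pr rise(3) by (simp add: b proper_def)
      ultimately have "completable i (z @ a) ([x] @ b) c"
        using less.prems(2) by (intro completable_below_bottom) auto
      then show ?thesis using Nil by simp
    qed
  next
    case (leave c' m)
    then show ?thesis using less.prems(2) by (auto dest: order.asym)
  qed
qed

section \<open>The fourth instruction: from the input to \<open>D1\<close>\<close>

lemma completable_enter_append:
  "completable i (rev ys @ a) b c \<Longrightarrow> completable (ys @ i) a b c"
  by (induction ys arbitrary: a) (auto intro: completable.enter)

text \<open>Only a run beginning with the rise of some \<open>t\<close> needs work. Then the initial
  input \<open>pre\<close> up to the first element above \<open>t\<close>, and all of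
  \<open>a\<close> and \<open>b\<close>, are at most \<open>t\<close>, while everything else exceeds
  \<open>t\<close>. If \<open>pre\<close> is empty, instruction 2 applies; otherwise \<gamma> makes
  \<open>pre\<close> increasing, so it can be pushed onto \<open>a\<close>, starting with
  \<open>u\<close>, and flushed together with \<open>a\<close> and \<open>b\<close>.\<close>

lemma completable_enter_input:
  assumes "completable (u # i) a b c" "\<forall>y\<in>set a. y < u" "\<forall>y\<in>set c. u < y"
    and seg: "sorted_wrt (<) (segment (top b) (u # i))"
    and no_shift: "\<not> (a \<noteq> [] \<and> (b = [] \<or> hd b < hd a) \<and> (c = [] \<or> hd a < hd c))"
    and no_flush: "\<not> (set a \<union> set b \<noteq> {} \<and>
      (\<forall>x\<in>set a \<union> set b. \<forall>y\<in>set (u # i) \<union> set c. x < y))"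
  shows "completable i (u # a) b c"
  using assms(1)
proof (cases rule: completable.cases)
  case (shift a' x)
  from completable_proper[OF shift(2)] have "\<forall>y\<in>set b. y < x" by (auto simp: proper_def)
  moreover have "\<forall>y\<in>set c. x < y"
    using assms(2,3) shift(1) by (metis list.set_intros(1) order.strict_trans)
  ultimately show ?thesis using no_shift shift(1) by (cases b; cases c) auto
next
  case (rise b' t)
  note pr = completable_proper[OF rise(2)]
  define pre where "pre = takeWhile (\<lambda>x. x \<le> t) (u # i)"
  define post where "post = dropWhile (\<lambda>x. x \<le> t) (u # i)"
  have split: "u # i = pre @ post" by (simp add: pre_def post_def)
  have pre_lt: "\<forall>y\<in>set pre. y < t"
    using pr set_takeWhileD[of _ "\<lambda>x. x \<le> t" "u # i"]
    by (fastforce simp: pre_def proper_def le_less)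
  have post_gt: "t < y" if "y \<in> set post" for y
  proof (cases post)
    case (Cons v vs)
    have "t < v" using Cons unfolding post_def by (metis dropWhile_eq_Cons_conv not_le)
    \<comment> \<open>After the rise, \<open>t\<close> lies in the increasing stack, so no input
      behind \<open>v > t\<close> can be smaller than \<open>t\<close>.\<close>
    moreover have "sorted_wrt (\<lambda>v w. \<not> (w < t \<and> t < v)) (pre @ v # vs)"
      using completable_crossing[OF rise(2), of t] split Cons by simp
    ultimately have "\<not> y < t" using that Cons by (auto simp: sorted_wrt_append)
    moreover have "y \<noteq> t" using pr that split by (auto simp: proper_def)
    ultimately show ?thesis by simp
  qed (use that in simp)
  have a_lt: "y < t" if "y \<in> set a" for y
  proof (cases a)
    case (Cons x a')
    with assms(2,3) have "\<forall>y\<in>set c. x < y" by (metis list.set_intros(1) order.strict_trans)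
    \<comment> \<open>As \<open>x\<close> is below the whole increasing stack, \<beta> can fail only
      through the comparison with \<open>t\<close>.\<close>
    with no_shift Cons rise(1) have "\<not> t < x" by (cases c) auto
    moreover have "t \<noteq> x" "\<forall>y\<in>set a'. y < x" using pr Cons by (auto simp: proper_def)
    ultimately show ?thesis using that Cons by force
  qed (use that in simp)
  have b_lt: "\<forall>y\<in>set b. y \<le> t" using rise by auto
  have c_gt: "\<forall>y\<in>set c. t < y" using pr by (auto simp: proper_def)
  show ?thesis
  proof (cases pre)
    case Nil
    with split post_gt have "\<forall>y\<in>set (u # i). t < y" by simp
    with a_lt b_lt c_gt have "\<forall>x\<in>set a \<union> set b. \<forall>y\<in>set (u # i) \<union> set c. x < y"
      by (metis Un_iff order.strict_trans order.strict_trans1)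
    with no_flush rise(1) show ?thesis by simp
  next
    case (Cons u' pre')
    with split have eq: "u' = u" "i = pre' @ post" by auto
    have "filter ((<) t) (u # i) = post"
      using pre_lt post_gt unfolding split by (auto simp: filter_id_conv filter_empty_conv)
    moreover have "filter ((<) t) a = []" "filter ((<) t) b' = []" "filter ((<) t) (t # c) = c"
      using a_lt rise(3) c_gt by (auto simp: filter_id_conv filter_empty_conv not_less less_imp_le)
    ultimately have "completable post [] [] c"
      using completable_filter[OF rise(2), of "(<) t"] by metis
    moreover have "sorted_wrt (>) (rev pre @ a)"
    proof -
      have "sorted_wrt (<) pre"
        using seg rise(1) by (simp add: top_def pre_def sorted_wrt_append)
      moreover have "\<forall>y\<in>set pre. \<forall>x\<in>set a. x < y"
        using Cons eq assms(2) \<open>sorted_wrt (<) pre\<close>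
        by (metis order.strict_trans set_ConsD sorted_wrt.simps(2))
      ultimately show ?thesis using pr by (auto simp: sorted_wrt_append sorted_wrt_rev proper_def)
    qed
    moreover have "sorted_wrt (>) b" "distinct ((rev pre @ a) @ b)"
      using completable_proper[OF assms(1)] unfolding split proper_def by auto
    moreover have "y < w" if "y \<in> set (rev pre @ a) \<union> set b" "w \<in> set post \<union> set [] \<union> set c" for y w
    proof -
      have "y \<le> t" using pre_lt a_lt b_lt that(1) by (auto intro: less_imp_le)
      also have "t < w" using post_gt c_gt that(2) by auto
      finally show ?thesis .
    qed
    ultimately have "completable post ((rev pre @ a) @ []) b c"
      by (intro completable_flush) auto
    then have "completable (pre' @ post) (u # a) b c"
      by (intro completable_enter_append) (simp add: Cons eq)
    then show ?thesis by (simp add: eq)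
  qed
qed (use assms in \<open>auto dest: order.asym\<close>)

section \<open>The fifth instruction, and why the sixth is never reached\<close>

text \<open>Before \<open>t\<close> rises the run can only read input: \<open>t\<close> is below all
  of \<open>c\<close>, which blocks output, and the top of \<open>D1\<close> is at least
  \<open>x\<close>, so moving it onto \<open>t\<close> would place an element above \<open>k\<close>
  in \<open>D2\<close> while \<open>t < k\<close> is still there. Reading input commutes with the
  rise of \<open>t\<close>.\<close>

lemma completable_rise_covered:
  assumes "completable i a (t # b) c" "k \<in> set c" "x \<in> set a" "k < x" "\<forall>y\<in>set c. t < y"
  shows "completable i a b (t # c)"
  using assms
proof (induction i a "t # b" c rule: completable.induct)
  case (enter i u a c)
  then show ?case by (auto intro: completable.enter)
next
  case (shift i a y c)
  then have "k < y" by force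
  then show ?case using completable_crossing[OF shift(1) shift.prems(1)] shift.prems by auto
qed (auto dest: order.asym)

text \<open>As long as \<open>D1\<close> stays below \<open>t\<close>, only input can precede the
  rise of \<open>t\<close>. Reading input leaves \<open>rev a @ p\<close> unchanged; as this list is
  not increasing, \<open>p\<close> never gets used up, so every element read lies in
  \<open>p\<close> and is below \<open>t\<close>.\<close>

lemma completable_rise_descent:
  assumes "completable i a (t # b) c" "\<forall>y\<in>set a. y < t" "i = p @ q" "\<forall>y\<in>set p. y < t"
    "\<not> sorted_wrt (<) (rev a @ p)" "\<forall>y\<in>set c. t < y"
  shows "completable i a b (t # c)"
  using assms
proof (induction i a "t # b" c arbitrary: p rule: completable.induct)
  case (enter i u a c)
  have "p \<noteq> []"
    using enter.prems(4) completable_proper[OF enter.hyps(1)]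
    by (auto simp: proper_def sorted_wrt_rev)
  then obtain p' where p: "p = u # p'" using enter.prems(2) by (cases p) auto
  show ?case
    by (rule completable.enter, rule enter.hyps(2)[of p']) (use enter.prems p in auto)
next
  case (shift i a x c)
  then show ?case using completable_proper[OF shift(1)] by (auto simp: proper_def)
qed (auto dest: order.asym)

text \<open>If the top of \<open>D1\<close>, or the input about to be read, exceeds an element of
  \<open>c\<close>, the rise can be advanced by \<open>completable_rise_covered\<close>. Otherwise
  \<gamma> fails through its segment, and \<open>completable_rise_descent\<close> applies.\<close>

lemma completable_rise_top:
  assumes "completable i a (t # b) c" "\<forall>y\<in>set c. t < y"
    and no_shift: "\<not> (a \<noteq> [] \<and> t < hd a \<and> (c = [] \<or> hd a < hd c))"
    and no_enter: "\<not> (i \<noteq> [] \<and> (a = [] \<or> hd a < hd i) \<and> (c = [] \<or> hd i < hd c) \<and>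
      sorted_wrt (<) (segment (Some t) i))"
  shows "completable i a b (t # c)"
proof (cases "\<exists>k\<in>set c. \<exists>x\<in>set a. k < x")
  case True
  then show ?thesis using assms(1,2) completable_rise_covered by blast
next
  case not_covered: False
  note pr = completable_proper[OF assms(1)]
  have a_lt: "y < t" if "y \<in> set a" for y
  proof (cases a)
    case (Cons x a')
    have "c = [] \<or> x < hd c"
      using not_covered Cons pr by (cases c) (auto simp: proper_def)
    with no_shift Cons have "\<not> t < x" by auto
    moreover have "t \<noteq> x" "\<forall>y\<in>set a'. y < x" using pr Cons by (auto simp: proper_def)
    ultimately show ?thesis using that Cons by force
  qed (use that in simp)
  from assms(1) show ?thesis
  proof (cases rule: completable.cases)
    case (enter i' u)
    note pr' = completable_proper[OF enter(2)]
    show ?thesis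
    proof (cases "\<exists>k\<in>set c. k < u")
      case True
      then have "completable i' (u # a) b (t # c)"
        using completable_rise_covered[OF enter(2)] assms(2) by auto
      then show ?thesis using enter(1) by (simp add: completable.enter)
    next
      case False
      then have "c = [] \<or> u < hd c" using pr' by (cases c) (auto simp: proper_def)
      moreover have "a = [] \<or> hd a < u" using pr' by (cases a) (auto simp: proper_def)
      ultimately have seg: "\<not> sorted_wrt (<) (segment (Some t) i)"
        using no_enter enter(1) by auto
      define p where "p = takeWhile (\<lambda>x. x \<le> t) i"
      define q where "q = dropWhile (\<lambda>x. x \<le> t) i"
      have pq: "i = p @ q" by (simp add: p_def q_def)
      have p_lt: "\<forall>y\<in>set p. y < t"
        using pr set_takeWhileD[of _ "\<lambda>x. x \<le> t" i]
        by (fastforce simp: p_def proper_def le_less)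
      have "t < v" if "q = v # vs" for v vs
        using that unfolding q_def by (metis dropWhile_eq_Cons_conv not_le)
      then have "\<forall>y\<in>set (take 1 q). t < y" by (cases q) auto
      moreover have "segment (Some t) i = p @ take 1 q" by (simp add: p_def q_def)
      moreover have "sorted_wrt (<) (take 1 q)" by (cases q) auto
      ultimately have "\<not> sorted_wrt (<) p"
        using seg p_lt by (auto simp: sorted_wrt_append dest: order.strict_trans)
      \<comment> \<open>The closing element of the segment, if any, exceeds \<open>t\<close> and
        hence all of \<open>p\<close>, so the failure lies within \<open>p\<close>.\<close>
      then have "\<not> sorted_wrt (<) (rev a @ p)" by (simp add: sorted_wrt_append)
      then show ?thesis using completable_rise_descent[OF assms(1) _ pq p_lt] a_lt assms(2) by auto
    qed
  next
    case (shift a' x)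
    have "t < x" using completable_proper[OF shift(2)] by (auto simp: proper_def)
    then show ?thesis using a_lt[of x] shift(1) by simp
  qed (use assms in \<open>auto dest: order.asym\<close>)
qed

text \<open>Every first move left to the run involves an element above \<open>hd c\<close> while a
  smaller one still waits, which \<open>completable_crossing\<close> excludes.\<close>

lemma not_completable_if_stuck:
  assumes "completable i a b c" "i \<noteq> [] \<or> a \<noteq> [] \<or> b \<noteq> [] \<or> c \<noteq> []"
    and no_leave: "c \<noteq> [] \<Longrightarrow> \<exists>w\<in>set i \<union> set a \<union> set b. w < hd c"
    and no_shift: "\<not> (a \<noteq> [] \<and> (b = [] \<or> hd b < hd a) \<and> (c = [] \<or> hd a < hd c))"
    and no_enter: "\<not> (i \<noteq> [] \<and> (a = [] \<or> hd a < hd i) \<and> (c = [] \<or> hd i < hd c) \<and>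
      sorted_wrt (<) (segment (top b) i))"
    and no_rise: "\<not> (b \<noteq> [] \<and> (c = [] \<or> hd b < hd c))"
  shows False
proof -
  note pr = completable_proper[OF assms(1)]
  have b: "b = []"
  proof (rule ccontr)
    assume "b \<noteq> []"
    then have c: "c \<noteq> []" "hd b \<in> set b" "hd c \<in> set c" "\<not> hd b < hd c" using no_rise by auto
    with pr have "hd c \<noteq> hd b" by (metis disjoint_iff distinct_append proper_def)
    with c completable_crossing[OF assms(1) c(3)] no_leave show False
      by (metis linorder_neqE_nat)
  qed
  from assms(1) show False
  proof (cases rule: completable.cases)
    case empty
    then show ?thesis using assms(2) by simp
  next
    case (enter i' u)
    note pr' = completable_proper[OF enter(2)]
    have "a = [] \<or> hd a < u" using pr' by (cases a) (auto simp: proper_def)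
    \<comment> \<open>With \<open>D2\<close> empty the segment is \<open>u\<close> alone, so only
      the comparison with \<open>c\<close> can have failed.\<close>
    then have c: "c \<noteq> []" "\<not> u < hd c" using no_enter enter(1) by (auto simp: b top_def)
    then have "hd c \<noteq> u" "hd c \<in> set c" using pr' by (cases c; auto simp: proper_def)+
    with c no_leave completable_crossing[OF enter(2), of "hd c"] show ?thesis
      by (auto simp: b enter(1))
  next
    case (shift a' x)
    note pr' = completable_proper[OF shift(2)]
    have c: "c \<noteq> []" "\<not> x < hd c" using no_shift shift(1) by (auto simp: b)
    then have "hd c \<noteq> x" "hd c \<in> set c" using pr' by (cases c; auto simp: proper_def)+
    with c no_leave completable_crossing[OF shift(2), of "hd c"] show ?thesis
      by (auto simp: b shift(1))
  next
    case (rise b' t)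
    then show ?thesis using b by simp
  next
    case (leave c' m)
    then show ?thesis using no_leave by (auto dest: order.asym)
  qed
qed

section \<open>Steps and runs of the algorithm\<close>

definition completable_state :: "state \<Rightarrow> bool" where
  "completable_state s \<longleftrightarrow> completable (inp s) (d1 s) (d2 s) (ist s)"

text \<open>The number of operations still to be performed: an input element needs four of
  them.\<close>

definition pending :: "state \<Rightarrow> nat" where
  "pending s = 4 * length (inp s) + 3 * length (d1 s) + 2 * length (d2 s) + length (ist s)"

text \<open>The final clause makes the outputs of successive steps concatenate to one increasing
  list.\<close>

definition emits :: "state \<Rightarrow> nat list \<Rightarrow> state \<Rightarrow> bool" where
  "emits s ys s' \<longleftrightarrow> out s' = out s @ ys \<and> sorted_wrt (<) ys \<and> remaining s = set ys \<union> remaining s' \<and>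
     (\<forall>y\<in>set ys. \<forall>w\<in>remaining s'. y < w)"

lemma ltE_top: "ltE (top xs) (top ys) \<longleftrightarrow> xs = [] \<or> ys = [] \<or> hd xs < hd ys"
  by (cases xs; cases ys) (auto simp: top_def)

lemma alg_step_completable:
  assumes comp: "completable_state s" and "\<not> finished s"
  shows "\<exists>s' ys. alg_step s = Some s' \<and> completable_state s' \<and> pending s' < pending s \<and> emits s ys s'"
proof -
  obtain i a b c r where s: "s = St i a b c r" by (cases s)
  have comp: "completable i a b c" using comp by (simp add: s completable_state_def)
  note pr = completable_proper[OF comp]
  have rem: "remaining s = set i \<union> set a \<union> set b \<union> set c" by (simp add: s remaining_def)
  then have fin: "finite (remaining s)" by simp
  consider
      (leave) "c \<noteq> []" "hd c = Min (remaining s)"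
    | (flush) "\<not> (c \<noteq> [] \<and> hd c = Min (remaining s))" "cond_flush s"
    | (move) "\<not> (c \<noteq> [] \<and> hd c = Min (remaining s))" "\<not> cond_flush s"
    by blast
  then show ?thesis
  proof cases
    case leave
    then obtain m c' where c: "c = m # c'" by (cases c) auto
    have "\<forall>w\<in>set i \<union> set a \<union> set b \<union> set c'. m \<le> w"
      using leave Min_le[OF fin] by (auto simp: rem c)
    moreover have "m \<notin> set i \<union> set a \<union> set b \<union> set c'" using pr by (auto simp: proper_def c)
    ultimately have m_lt: "\<forall>w\<in>set i \<union> set a \<union> set b \<union> set c'. m < w"
      by (metis order.not_eq_order_implies_strict)
    have filters: "filter ((\<noteq>) m) i = i" "filter ((\<noteq>) m) a = a" "filter ((\<noteq>) m) b = b"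
      "filter ((\<noteq>) m) c = c'"
      using m_lt by (auto simp: c filter_id_conv)
    have "completable i a b c'"
      using completable_filter[OF comp, of "(\<noteq>) m"] unfolding filters .
    moreover have "alg_step s = Some (do_d3 s)"
      using leave assms(2) by (simp add: alg_step_def s)
    ultimately show ?thesis using m_lt
      by (intro exI[of _ "do_d3 s"] exI[of _ "[m]"])
        (auto simp: s c do_d3_def completable_state_def pending_def emits_def remaining_def)
  next
    case flush
    let ?D = "set a \<union> set b"
    have D: "?D \<noteq> {}" "\<forall>x\<in>?D. \<forall>y\<in>remaining s - ?D. x < y"
      using flush(2) by (auto simp: cond_flush_def s Let_def)
    have disj: "?D \<inter> set i = {}" "?D \<inter> set c = {}" using pr by (auto simp: proper_def)
    have D_lt: "\<forall>x\<in>?D. \<forall>y\<in>set i \<union> set c. x < y" using D(2) disj by (auto simp: rem)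
    have filters: "filter (\<lambda>x. x \<notin> ?D) i = i" "filter (\<lambda>x. x \<notin> ?D) c = c"
      "filter (\<lambda>x. x \<notin> ?D) a = []" "filter (\<lambda>x. x \<notin> ?D) b = []"
      using disj by (auto simp: filter_id_conv filter_empty_conv)
    have "completable i [] [] c"
      using completable_filter[OF comp, of "\<lambda>x. x \<notin> ?D"] unfolding filters .
    moreover have "alg_step s = Some (do_flush s)"
      using flush assms(2) by (auto simp: alg_step_def s)
    moreover have "sorted_wrt (<) (sort (a @ b))"
      using pr by (auto simp: strict_sorted_iff proper_def)
    ultimately show ?thesis using D(1) D_lt
      by (intro exI[of _ "do_flush s"] exI[of _ "sort (a @ b)"])
        (auto simp: s do_flush_def completable_state_def pending_def emits_def remaining_def)
  next
    case move
    \<comment> \<open>Instruction 1 fails, so the least remaining element is not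
      \<open>hd c\<close>; as \<open>c\<close> is increasing, it lies outside
      \<open>c\<close>.\<close>
    have no_leave: "\<exists>w\<in>set i \<union> set a \<union> set b. w < hd c" if "c \<noteq> []"
    proof -
      obtain m c' where c: "c = m # c'" using \<open>c \<noteq> []\<close> by (cases c) auto
      have "Min (remaining s) \<in> remaining s" using c rem by (intro Min_in) auto
      moreover have "Min (remaining s) < m"
        using move(1) Min_le[OF fin, of m] by (auto simp: rem c order.order_iff_strict)
      moreover have "\<forall>y\<in>set c'. m < y" using pr by (simp add: proper_def c)
      ultimately show ?thesis by (auto simp: rem c dest: order.asym)
    qed
    have no_flush: "\<not> (set a \<union> set b \<noteq> {} \<and>
      (\<forall>x\<in>set a \<union> set b. \<forall>y\<in>set i \<union> set c. x < y))"
      using move(2) by (auto simp: cond_flush_def s Let_def remaining_def)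
    have alg: "alg_step s =
      (if legal_d1 s \<and> cond_beta s then Some (do_d1 s)
       else if legal_d0 s \<and> cond_gamma s then Some (do_d0 s)
       else if legal_d2 s \<and> cond_alpha s then Some (do_d2 s)
       else if legal_d3 s then Some (do_d3 s) else None)"
      using move assms(2) by (auto simp: alg_step_def s)
    have c_gt: "\<forall>y\<in>set c. x < y" if "c = [] \<or> x < hd c" for x
      using that pr by (cases c) (auto simp: proper_def)
    \<comment> \<open>\<open>S\<close>, \<open>E\<close> and \<open>R\<close> are the full guards of
      instructions 3, 4 and 5 with the empty-stack conventions written out.\<close>
    define S where "S \<longleftrightarrow> a \<noteq> [] \<and> (b = [] \<or> hd b < hd a) \<and> (c = [] \<or> hd a < hd c)"
    define E where "E \<longleftrightarrow> i \<noteq> [] \<and> (a = [] \<or> hd a < hd i) \<and> (c = [] \<or> hd i < hd c) \<and>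
      sorted_wrt (<) (segment (top b) i)"
    define R where "R \<longleftrightarrow> b \<noteq> [] \<and> (c = [] \<or> hd b < hd c)"
    have conds: "legal_d1 s \<and> cond_beta s \<longleftrightarrow> S" "legal_d0 s \<and> cond_gamma s \<longleftrightarrow> E"
      "legal_d2 s \<and> cond_alpha s \<longleftrightarrow> R"
      by (auto simp: s S_def E_def R_def ltE_top legal_d0_def legal_d1_def legal_d2_def
          cond_alpha_def cond_beta_def cond_gamma_def)
    show ?thesis
    proof (cases S)
      case True
      then obtain x a' where a: "a = x # a'" by (cases a) (auto simp: S_def)
      have "\<forall>y\<in>set b. y < x" using True pr by (cases b) (auto simp: S_def a proper_def)
      then have "completable i a' (x # b) c"
        using completable_shift_top[of i "[]" x a' "[]" b c] comp c_gt[of x] True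
        by (simp add: a S_def)
      with True show ?thesis
        by (intro exI[of _ "do_d1 s"] exI[of _ "[]"])
          (auto simp: alg conds, auto simp: s a do_d1_def completable_state_def
            pending_def emits_def remaining_def)
    next
      case no_S: False
      show ?thesis
      proof (cases E)
        case True
        then obtain u i' where i: "i = u # i'" by (cases i) (auto simp: E_def)
        have "\<forall>y\<in>set a. y < u" using True pr by (cases a) (auto simp: E_def i proper_def)
        moreover have "\<forall>y\<in>set c. u < y" using c_gt[of u] True by (simp add: E_def i)
        ultimately have "completable i' (u # a) b c"
          using completable_enter_input[of u i' a b c] comp no_S no_flush True
          by (simp add: i S_def E_def)
        with True no_S show ?thesis
          by (intro exI[of _ "do_d0 s"] exI[of _ "[]"])
            (auto simp: alg conds, auto simp: s i do_d0_def completable_state_def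
              pending_def emits_def remaining_def)
      next
        case no_E: False
        have R
          using not_completable_if_stuck[OF comp _ no_leave] no_S no_E assms(2)
          by (auto simp: s finished_def S_def E_def R_def)
        then obtain t b' where b: "b = t # b'" by (cases b) (auto simp: R_def)
        have "completable i a b' (t # c)"
          using completable_rise_top[of i a t b' c] comp c_gt[of t] no_S no_E \<open>R\<close>
          by (simp add: b S_def E_def R_def top_def)
        with \<open>R\<close> no_S no_E show ?thesis
          by (intro exI[of _ "do_d2 s"] exI[of _ "[]"])
            (auto simp: alg conds, auto simp: s b do_d2_def completable_state_def
              pending_def emits_def remaining_def)
      qed
    qed
  qed
qed

lemma alg_run_completable:
  assumes "completable_state s"
  shows "\<exists>s' ys. alg_rel\<^sup>*\<^sup>* s s' \<and> finished s' \<and> emits s ys s'"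
  using assms
proof (induction "pending s" arbitrary: s rule: less_induct)
  case less
  show ?case
  proof (cases "finished s")
    case True
    then show ?thesis by (intro exI[of _ s] exI[of _ "[]"]) (simp add: emits_def)
  next
    case False
    then obtain s1 ys where s1: "alg_rel s s1" "completable_state s1" "pending s1 < pending s"
      and ys: "emits s ys s1"
      using alg_step_completable less.prems unfolding alg_rel_def by blast
    from less.hyps[OF s1(3,2)] obtain s' zs
      where "alg_rel\<^sup>*\<^sup>* s1 s'" "finished s'" and zs: "emits s1 zs s'" by blast
    moreover have "emits s (ys @ zs) s'"
      using ys zs by (auto simp: emits_def sorted_wrt_append)
    ultimately show ?thesis using s1(1) by (meson converse_rtranclp_into_rtranclp)
  qed
qed

section \<open>From legal runs to completable states\<close>

definition contents :: "state \<Rightarrow> nat list" where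
  "contents s = inp s @ d1 s @ d2 s @ ist s @ out s"

text \<open>Sortability speaks only of the final output; conservation of the elements shows that
  input and stacks are then empty.\<close>

lemma mstep_contents: "mstep\<^sup>*\<^sup>* s s' \<Longrightarrow> mset (contents s') = mset (contents s)"
proof (induction rule: rtranclp_induct)
  case (step s1 s2)
  have "mset (contents s2) = mset (contents s1)"
    using step.hyps(2)
    by (cases "inp s1"; cases "d1 s1"; cases "d2 s1"; cases "ist s1")
      (auto simp: mstep_def contents_def do_d0_def do_d1_def do_d2_def do_d3_def
        legal_d0_def legal_d1_def legal_d2_def legal_d3_def)
  with step.IH show ?case by simp
qed simp

text \<open>The induction goes backwards along the run. For \<open>d3\<close> the popped element is
  minimal because the final output is strictly increasing and, by the second conjunct, lists all
  that remains behind it. Legality compares with tops only, which suffices as \<open>D1\<close> and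
  \<open>D2\<close> are decreasing.\<close>

lemma completable_if_mstep:
  assumes "mstep\<^sup>*\<^sup>* s s'" "finished s'" "sorted_wrt (<) (out s')"
    "sorted_wrt (>) (d1 s)" "sorted_wrt (>) (d2 s)"
  shows "completable_state s \<and> (\<exists>ys. out s' = out s @ ys \<and> set ys = remaining s)"
  using assms(1,4,5)
proof (induction rule: converse_rtranclp_induct)
  case base
  then show ?case using assms(2)
    by (auto simp: completable_state_def finished_def remaining_def completable.empty)
next
  case (step s s1)
  obtain i a b c r where s: "s = St i a b c r" by (cases s)
  from step.hyps(1) consider "legal_d0 s" "s1 = do_d0 s" | "legal_d1 s" "s1 = do_d1 s"
    | "legal_d2 s" "s1 = do_d2 s" | "legal_d3 s" "s1 = do_d3 s"
    by (auto simp: mstep_def)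
  then show ?case
  proof cases
    case 1
    then obtain u i' where i: "i = u # i'" by (cases i) (auto simp: legal_d0_def s)
    have "sorted_wrt (>) (u # a)"
      using 1 step.prems by (cases a) (auto simp: legal_d0_def s i top_def)
    then show ?thesis using step.IH step.prems 1
      by (auto simp: s i do_d0_def completable_state_def remaining_def intro: completable.enter)
  next
    case 2
    then obtain x a' where a: "a = x # a'" by (cases a) (auto simp: legal_d1_def s)
    have "sorted_wrt (>) (x # b)"
      using 2 step.prems by (cases b) (auto simp: legal_d1_def s a top_def)
    then show ?thesis using step.IH step.prems 2
      by (auto simp: s a do_d1_def completable_state_def remaining_def intro: completable.shift)
  next
    case 3
    then obtain t b' where b: "b = t # b'" by (cases b) (auto simp: legal_d2_def s)
    then show ?thesis using step.IH step.prems 3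
      by (auto simp: s b do_d2_def completable_state_def remaining_def intro: completable.rise)
  next
    case 4
    then obtain m c' where c: "c = m # c'" by (cases c) (auto simp: legal_d3_def s)
    with step.IH step.prems 4 obtain ys where ys: "completable i a b c'" "out s' = r @ m # ys"
      "set ys = set i \<union> set a \<union> set b \<union> set c'"
      by (auto simp: s do_d3_def completable_state_def remaining_def)
    then have "\<forall>y\<in>set i \<union> set a \<union> set b \<union> set c'. m < y"
      using assms(3) by (simp add: sorted_wrt_append)
    then have "completable i a b c" using ys(1) by (auto simp: c intro: completable.leave)
    then show ?thesis using ys by (auto simp: s c completable_state_def remaining_def)
  qed
qed

theorem mainTheorem11:
  fixes p :: "nat list"
  assumes "distinct p" and "set p = {1..length p}"
    and "two_sortable p"
  shows "\<exists>s. alg_rel\<^sup>*\<^sup>* (init p) s \<and> finished s \<and> out s = sort p"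
proof -
  from assms(3) obtain s0 where run: "mstep\<^sup>*\<^sup>* (init p) s0" and out: "out s0 = sort p"
    by (auto simp: two_sortable_def)
  have sorted: "sorted_wrt (<) (sort p)" using assms(1) by (simp add: strict_sorted_iff)
  have "mset (inp s0) + mset (d1 s0) + mset (d2 s0) + mset (ist s0) = {#}"
    using mstep_contents[OF run] out by (simp add: contents_def init_def)
  then have "finished s0" by (simp add: finished_def)
  then have "completable_state (init p)"
    using completable_if_mstep[OF run] out sorted by (simp add: init_def)
  then obtain s ys where s: "alg_rel\<^sup>*\<^sup>* (init p) s" "finished s" and ys: "emits (init p) ys s"
    using alg_run_completable by blast
  have "out s = ys" "sorted_wrt (<) ys" "set ys = set p"
    using ys s(2) by (auto simp: emits_def init_def remaining_def finished_def)
  then have "out s = sort p"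
    using sorted by (metis set_sort strict_sorted_equal)
  with s show ?thesis by blast
qed

end
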